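(* (i) For every $n$, there exist arbitrarily long primitive perfectly clustering Arnoux-Rauzy words with at least $n$ occurrences of each of the letters $a,b,c$. (ii) Every Arnoux-Rauzy language contains a primitive perfectly clustering word of length at least $22$.
   Context: A (nonempty) word is primitive if it is not a power of another word. AR (Arnoux-Rauzy) languages. The alphabet is $\{a,b,c\}$. Given an infinite sequence of rules $(x_k)_{k\ge0}$, $x_k\in\{a,b,c\}$, in which each of $a,b,c$ occurs infinitely often, define words by $A_0=a$, $B_0=b$, $C_0=c$ and: by rule $(a)$ at stage $k$ (i.e. $x_k=a$), $A_{k+1}=A_k$, $B_{k+1}=B_kA_k$, $C_{k+1}=C_kA_k$; by rule $(b)$, $A_{k+1}=A_kB_k$, $B_{k+1}=B_k$, $C_{k+1}=C_kB_k$; by rule $(c)$, $A_{k+1}=A_kC_k$, $B_{k+1}=B_kC_k$, $C_{k+1}=C_k$. The AR language $\Lambda$ is the set of all factors of the words $A_k,B_k,C_k$, $k\ge0$. An Arnoux-Rauzy (AR) word is an element of some AR language. Clustering. For a total order on the alphabet, written $a_1<\dots<a_r$, the Burrows-Wheeler transform $B(w)$ of a word $w=w_1\cdots w_n$ is obtained by listing its $n$ cyclic conjugates $w_i\cdots w_nw_1\cdots w_{i-1}$ (with multiplicity) in nondecreasing lexicographical order and reading the sequence of their last letters. The word $w$ clusters for this order and a permutation $\pi\neq \mathrm{Id}$ of the alphabet if $B(w)=(\pi a_1)^{n_{\pi a_1}}\cdots(\pi a_r)^{n_{\pi a_r}}$, where $n_a\ge0$ is the number of occurrences of $a$ in $w$.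 It is perfectly clustering if, for some order on $\{a,b,c\}$, it clusters for the symmetric permutation $\pi a_i=a_{r+1-i}$. *)

theory Defs
  imports "HOL-Library.Sublist" "HOL-Library.Multiset"
begin

definition primitive :: "'a list \<Rightarrow> bool" where
  "primitive w \<longleftrightarrow> w \<noteq> [] \<and> (\<forall>u m. w = concat (replicate m u) \<longrightarrow> u = w)"

datatype letter = LA | LB | LC

text \<open>\<open>AR_stage x k l\<close> is the word $A_k$, $B_k$ or $C_k$, according to the letter \<open>l\<close>,
  produced by the rules \<open>x 0, \<dots>, x (k - 1)\<close>.\<close>

fun AR_stage :: "(nat \<Rightarrow> letter) \<Rightarrow> nat \<Rightarrow> letter \<Rightarrow> letter list" where
  "AR_stage x 0 l = [l]"
| "AR_stage x (Suc k) l =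
     (if l = x k then AR_stage x k l else AR_stage x k l @ AR_stage x k (x k))"

definition AR_rules :: "(nat \<Rightarrow> letter) \<Rightarrow> bool" where
  "AR_rules x \<longleftrightarrow> (\<forall>l. infinite {k. x k = l})"

definition AR_language_of :: "(nat \<Rightarrow> letter) \<Rightarrow> letter list set" where
  "AR_language_of x = {w. \<exists>k l. sublist w (AR_stage x k l)}"

definition AR_language :: "letter list set \<Rightarrow> bool" where
  "AR_language L \<longleftrightarrow> (\<exists>x. AR_rules x \<and> L = AR_language_of x)"

definition AR_word :: "letter list \<Rightarrow> bool" where
  "AR_word w \<longleftrightarrow> (\<exists>L. AR_language L \<and> w \<in> L)"

text \<open>A total order $a_1 < \dots < a_r$ on a finite alphabet (a whole type) is given by the list
  of all letters in increasing order.\<close>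

definition alphabet_order :: "'a list \<Rightarrow> bool" where
  "alphabet_order as \<longleftrightarrow> distinct as \<and> set as = UNIV"

definition letter_less :: "'a list \<Rightarrow> ('a \<times> 'a) set" where
  "letter_less as = {(as ! i, as ! j) | i j. i < j \<and> j < length as}"

definition conjugates :: "'a list \<Rightarrow> 'a list list" where
  "conjugates w = map (\<lambda>i. rotate i w) [0..<length w]"

definition lex_listing :: "'a list \<Rightarrow> 'a list \<Rightarrow> 'a list list \<Rightarrow> bool" where
  "lex_listing as w cs \<longleftrightarrow>
     mset cs = mset (conjugates w) \<and> sorted_wrt (\<lambda>u v. u = v \<or> (u, v) \<in> lexord (letter_less as)) cs"

definition bw_transform :: "'a list \<Rightarrow> 'a list \<Rightarrow> 'a list" where
  "bw_transform as w = map last (THE cs. lex_listing as w cs)"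

definition clusters :: "'a list \<Rightarrow> ('a \<Rightarrow> 'a) \<Rightarrow> 'a list \<Rightarrow> bool" where
  "clusters as \<pi> w \<longleftrightarrow> bij \<pi> \<and> \<pi> \<noteq> id \<and>
     bw_transform as w = concat (map (\<lambda>a. replicate (count_list w (\<pi> a)) (\<pi> a)) as)"

text \<open>The symmetric permutation $\pi a_i = a_{r+1-i}$, with indices shifted to start at 0.\<close>

definition symmetric_perm :: "'a list \<Rightarrow> ('a \<Rightarrow> 'a) \<Rightarrow> bool" where
  "symmetric_perm as \<pi> \<longleftrightarrow> (\<forall>i<length as. \<pi> (as ! i) = as ! (length as - 1 - i))"

definition perfectly_clustering :: "'a list \<Rightarrow> bool" where
  "perfectly_clustering w \<longleftrightarrow>
     (\<exists>as \<pi>. alphabet_order as \<and> symmetric_perm as \<pi> \<and> clusters as \<pi> w)"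

text \<open>The description in \<^const>\<open>bw_transform\<close> is proper: the sorted listing exists and is
  unique.\<close>

lemma letter_less_linear:
  assumes "alphabet_order as"
  shows "irrefl (letter_less as)" "trans (letter_less as)" "total (letter_less as)"
proof -
  have d: "distinct as" and s: "set as = UNIV"
    using assms by (auto simp: alphabet_order_def)
  show "irrefl (letter_less as)"
    using d by (auto simp: irrefl_def letter_less_def nth_eq_iff_index_eq)
  show "trans (letter_less as)"
  proof (rule transI)
    fix x y z assume "(x, y) \<in> letter_less as" "(y, z) \<in> letter_less as"
    then obtain i j j' k where *: "x = as ! i" "y = as ! j" "i < j" "j < length as"
      "y = as ! j'" "z = as ! k" "j' < k" "k < length as"
      by (auto simp: letter_less_def)
    then have "j = j'" using d by (simp add: nth_eq_iff_index_eq)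
    with * have "i < k" by simp
    with * show "(x, z) \<in> letter_less as" by (auto simp: letter_less_def)
  qed
  show "total (letter_less as)"
  proof (rule totalI)
    fix x y :: 'a assume "x \<noteq> y"
    obtain i j where *: "x = as ! i" "i < length as" "y = as ! j" "j < length as"
      using s by (metis UNIV_I in_set_conv_nth)
    with \<open>x \<noteq> y\<close> have "i < j \<or> j < i" by (metis nat_neq_iff)
    with * show "(x, y) \<in> letter_less as \<or> (y, x) \<in> letter_less as"
      by (auto simp: letter_less_def)
  qed
qed

lemma lex_listing_ex1:
  assumes "alphabet_order as"
  shows "\<exists>!cs. lex_listing as w cs"
proof -
  define le where "le u v \<longleftrightarrow> u = v \<or> (u, v) \<in> lexord (letter_less as)" for u v
  note ll = letter_less_linear[OF assms]
  have tr: "trans (lexord (letter_less as))" using lexord_trans[OF _ _ ll(2)] by (blast intro: transI)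
  have ir: "(u, u) \<notin> lexord (letter_less as)" for u
    using ll(1) by (simp add: irrefl_def lexord_irreflexive)
  have tot: "u = v \<or> (u, v) \<in> lexord (letter_less as) \<or> (v, u) \<in> lexord (letter_less as)" for u v
    using total_lexord[OF ll(3)] by (auto simp: total_on_def)
  interpret linorder le "\<lambda>u v. (u, v) \<in> lexord (letter_less as)"
    using tr ir tot by unfold_locales (unfold le_def, (metis transD)+)
  have eq: "lex_listing as w cs \<longleftrightarrow> mset cs = mset (conjugates w) \<and> sorted_wrt le cs" for cs
    by (simp add: lex_listing_def le_def[abs_def])
  show ?thesis
  proof (rule ex1I)
    show "lex_listing as w (sort_key (\<lambda>u. u) (conjugates w))"
      using sorted_sort_key[of "\<lambda>u. u" "conjugates w"] by (simp add: eq)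
    show "cs = sort_key (\<lambda>u. u) (conjugates w)" if "lex_listing as w cs" for cs
      using that properties_for_sort[of cs "conjugates w"] by (simp add: eq)
  qed
qed

end

theory Submission
  imports Defs "HOL-Library.Infinite_Set"
begin

text \<open>Write $\sigma_r$ for the substitution $l \mapsto lr$ ($l \neq r$), $r \mapsto r$. The words
  $A_k, B_k, C_k$ are the images of the letters under
  $\sigma_{x_0} \circ \dots \circ \sigma_{x_{k-1}}$, so a factor $v$ of the language generated by
  the rules $x_k, x_{k+1}, \dots$ has its image in the language of $x$. Both halves choose a very
  simple $v$ and show that clustering passes to its image.

  A word clusters perfectly as soon as larger rotations never have larger last letters
  (\<open>clusters_if_reverses_last_letters\<close>). This property passes from $v$ to $\sigma_r(v)$ unless $r$
  lies strictly between two letters of $v$ (\<open>reverses_last_letters_subst\<close>): the rotations of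
  $\sigma_r(v)$ beginning with $r$ are compared, and end, as rotations of $v$ do, while all others
  end with $r$. The greatest common divisor of the letter counts is also unchanged by $\sigma_r$;
  when it is 1, the word is primitive.

  Let $a$, $b$, $c$ be the letters in the order in which they first occur as rules, and order the
  alphabet by $a < c < b$. Before the first rule $c$, at stage $k$, every rule is extreme, so any
  $v$ may be taken there. From stage $k$ on, $c$ is the rule for a while, up to a stage $K$ with
  rule $l \neq c$; this is harmless as long as $v$ contains only $l$ and $c$. With rules
  $a, b, c^n$ and $v = a$ this proves the first half (\<open>clustering_word_with_many_letters\<close>). For
  the second half (\<open>clustering_word_of_length_22\<close>), $lcl$ is always a factor at stage $K$, and its
  image has length at least 22, except when the rules begin with $a, b, c, l$. In that case the
  image of $llcl$ is used: $llcl$ need not be a factor at stage 3, but its image is nonetheless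
  in the language, because $A_2$ and $B_2$ are suffixes of every product of two words of stage 2
  (\<open>image_in_AR_language\<close>). Its length is $3 |B_3| + |C_3| = 3 \cdot 6 + 4 = 22$ for $l = b$
  and 25 for $l = a$.\<close>

section \<open>Substitutions and stages\<close>

definition ar_subst :: "'a \<Rightarrow> 'a list \<Rightarrow> 'a list" where
  "ar_subst r v = concat (map (\<lambda>l. if l = r then [r] else [l, r]) v)"

definition ar_image :: "(nat \<Rightarrow> letter) \<Rightarrow> nat \<Rightarrow> letter list \<Rightarrow> letter list" where
  "ar_image x k v = concat (map (AR_stage x k) v)"

lemma ar_subst_simps [simp]:
  "ar_subst r [] = []"
  "ar_subst r (l # v) = (if l = r then [r] else [l, r]) @ ar_subst r v"
  "ar_subst r (u @ v) = ar_subst r u @ ar_subst r v"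
  by (auto simp: ar_subst_def)

lemma ar_subst_eq_Nil [simp]: "ar_subst r v = [] \<longleftrightarrow> v = []"
  by (cases v) auto

lemma last_ar_subst: "v \<noteq> [] \<Longrightarrow> last (ar_subst r v) = r"
  by (cases v rule: rev_cases) auto

lemma set_ar_subst: "set (ar_subst r v) \<subseteq> insert r (set v)"
  by (auto simp: ar_subst_def split: if_splits)

lemma ar_image_append [simp]: "ar_image x k (u @ v) = ar_image x k u @ ar_image x k v"
  by (simp add: ar_image_def)

lemma ar_image_0 [simp]: "ar_image x 0 v = v"
  by (induction v) (auto simp: ar_image_def)

lemma ar_image_single [simp]: "ar_image x k [l] = AR_stage x k l"
  by (simp add: ar_image_def)

text \<open>The stages are defined by appending at the outside; here the last rule acts innermost, as a
  substitution, which allows desubstitution.\<close>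

lemma ar_image_Suc: "ar_image x (Suc k) v = ar_image x k (ar_subst (x k) v)"
  by (induction v) (auto simp: ar_image_def)

lemma ar_image_add: "ar_image x (k + j) v = ar_image x k (ar_image (\<lambda>i. x (k + i)) j v)"
  by (induction j arbitrary: v) (auto simp: ar_image_Suc)

lemma length_ar_image: "length (ar_image x k v) = (\<Sum>l\<leftarrow>v. length (AR_stage x k l))"
  by (simp add: ar_image_def length_concat o_def)

lemma length_AR_stage_mono:
  assumes "k \<le> k'"
  shows "length (AR_stage x k l) \<le> length (AR_stage x k' l)"
  using assms by (induction k' rule: dec_induct) auto

section \<open>Factors of an Arnoux-Rauzy language\<close>

lemma AR_language_ofI: "sublist w (AR_stage x k l) \<Longrightarrow> w \<in> AR_language_of x"
  by (auto simp: AR_language_of_def)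

lemma AR_language_of_sublist:
  "w \<in> AR_language_of x \<Longrightarrow> sublist u w \<Longrightarrow> u \<in> AR_language_of x"
  by (auto simp: AR_language_of_def intro: sublist_order.order_trans)

lemma AR_rules_shift:
  assumes "AR_rules x" shows "AR_rules (\<lambda>i. x (k + i))"
  unfolding AR_rules_def
proof
  fix l
  have "{i. x i = l} \<subseteq> {..<k} \<union> (\<lambda>i. k + i) ` {i. x (k + i) = l}"
  proof
    fix i assume "i \<in> {i. x i = l}"
    then show "i \<in> {..<k} \<union> (\<lambda>i. k + i) ` {i. x (k + i) = l}"
      by (cases "i < k") (auto intro!: image_eqI[of _ _ "i - k"])
  qed
  moreover have "infinite {i. x i = l}" using assms by (auto simp: AR_rules_def)
  ultimately show "infinite {i. x (k + i) = l}"
    by (meson finite_UnI finite_imageI finite_lessThan finite_subset)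
qed

lemma AR_rules_later:
  assumes "AR_rules x" shows "\<exists>i\<ge>k. x i = l"
  using assms unfolding AR_rules_def infinite_nat_iff_unbounded_le by blast

lemma ar_image_in_language:
  assumes "v \<in> AR_language_of (\<lambda>i. x (k + i))"
  shows "ar_image x k v \<in> AR_language_of x"
proof -
  obtain j l p s where "AR_stage (\<lambda>i. x (k + i)) j l = p @ v @ s"
    using assms by (auto simp: AR_language_of_def sublist_def)
  then have "AR_stage x (k + j) l = ar_image x k p @ ar_image x k v @ ar_image x k s"
    using ar_image_add[of x k j "[l]"] by simp
  then show ?thesis by (intro AR_language_ofI[of _ _ "k + j" l]) simp
qed

lemma prefix_AR_stage:
  assumes "k \<le> k'"
  shows "prefix (AR_stage x k l) (AR_stage x k' l)"
  using assms by (induction k' rule: dec_induct) (auto intro: prefix_prefix)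

lemma AR_stage_neq_Nil [simp]: "AR_stage x k l \<noteq> []"
  by (induction k) auto

text \<open>A stage word stays a prefix of its successors; at a later stage whose rule is its own letter it is
  appended to the other two words, so something precedes it.\<close>

lemma AR_language_left_extension:
  assumes x: "AR_rules x" and v: "v \<in> AR_language_of x"
  shows "\<exists>s. s # v \<in> AR_language_of x"
proof -
  obtain k l where kl: "sublist v (AR_stage x k l)"
    using v by (auto simp: AR_language_of_def)
  obtain k' where k': "k' \<ge> k" "x k' = l" using AR_rules_later[OF x] by blast
  obtain q where q: "q \<noteq> l" by (metis letter.distinct(1))
  obtain p t where pt: "AR_stage x k' l = p @ v @ t"
    using sublist_order.order_trans[OF kl prefix_imp_sublist[OF prefix_AR_stage[OF k'(1)]]]
    by (auto simp: sublist_def)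
  define u where "u = AR_stage x k' q @ p"
  have "AR_stage x (Suc k') q = u @ v @ t" using q k' pt by (simp add: u_def)
  moreover have "u = butlast u @ [last u]" by (simp add: u_def)
  ultimately have "AR_stage x (Suc k') q = butlast u @ (last u # v) @ t"
    by (metis append.assoc append_Cons append_Nil)
  then have "last u # v \<in> AR_language_of x"
    by (intro AR_language_ofI[of _ _ "Suc k'" q]) (metis sublist_appendI)
  then show ?thesis ..
qed

lemma single_in_AR_language: "[l] \<in> AR_language_of x"
  by (rule AR_language_ofI[of _ _ 0 l]) simp

text \<open>One desubstitution shows this: every $m$ has a left neighbour $s$ in the language of the remaining
  rules, and $\sigma_r(s)$ ends with the rule letter $r$ while $\sigma_r(m) = mr$.\<close>

lemma return_factor_in_AR_language:
  assumes x: "AR_rules x" and m: "m \<noteq> x 0"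
  shows "[x 0, m, x 0] \<in> AR_language_of x"
proof -
  have "AR_rules (\<lambda>i. x (1 + i))" by (rule AR_rules_shift[OF x])
  then obtain s where "[s, m] \<in> AR_language_of (\<lambda>i. x (1 + i))"
    using AR_language_left_extension single_in_AR_language by blast
  then have "ar_image x 1 [s, m] \<in> AR_language_of x" by (rule ar_image_in_language)
  moreover have "ar_image x 1 [s, m] = butlast (ar_subst (x 0) [s]) @ [x 0, m, x 0]"
    using m by (simp add: ar_image_Suc)
  ultimately show ?thesis
    by (metis AR_language_of_sublist suffix_imp_sublist suffixI)
qed

section \<open>Words whose rotations reverse their last letters\<close>

text \<open>This is the criterion for perfect clustering in terms of pairs of rotations: the last letters of
  the sorted rotations are nonincreasing. It avoids the sorted listing, and it is manifestly
  invariant under rotation.\<close>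

definition reverses_last_letters :: "'a list \<Rightarrow> 'a list \<Rightarrow> bool" where
  "reverses_last_letters as w \<longleftrightarrow>
     (\<forall>i j. (rotate i w, rotate j w) \<in> lexord (letter_less as) \<longrightarrow>
        last (rotate i w) = last (rotate j w) \<or>
        (last (rotate j w), last (rotate i w)) \<in> letter_less as)"

lemma lexord_letter_less:
  assumes "alphabet_order as"
  shows "(u, u) \<notin> lexord (letter_less as)"
    and "(u, v) \<in> lexord (letter_less as) \<Longrightarrow> (v, u) \<notin> lexord (letter_less as)"
    and "u = v \<or> (u, v) \<in> lexord (letter_less as) \<or> (v, u) \<in> lexord (letter_less as)"
proof -
  note ll = letter_less_linear[OF assms]
  show ir: "(u, u) \<notin> lexord (letter_less as)" for u
    using ll(1) by (simp add: irrefl_def lexord_irreflexive)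
  show "(u, v) \<in> lexord (letter_less as) \<Longrightarrow> (v, u) \<notin> lexord (letter_less as)"
    using ir lexord_trans[OF _ _ ll(2)] by blast
  show "u = v \<or> (u, v) \<in> lexord (letter_less as) \<or> (v, u) \<in> lexord (letter_less as)"
    using total_lexord[OF ll(3)] by (auto simp: total_on_def)
qed

text \<open>A substituted letter still begins with that letter, so the first difference of two words is also
  the first difference of their images.\<close>

lemma ar_subst_lexord_mono:
  assumes "irrefl R" "(u, v) \<in> lexord R"
  shows "(ar_subst r u, ar_subst r v) \<in> lexord R"
proof -
  consider a t where "v = u @ a # t"
    | p d d' s s' where "(d, d') \<in> R" "d \<noteq> d'" "u = p @ d # s" "v = p @ d' # s'"
    using assms unfolding lexord_def irrefl_def by blast
  then show ?thesis
  proof cases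
    case 1
    then show ?thesis by (auto simp: lexord_append_rightI)
  next
    case 2
    then have "(ar_subst r (d # s), ar_subst r (d' # s')) \<in> lexord R" by auto
    then show ?thesis using 2 by (simp add: lexord_append_leftI)
  qed
qed

lemma ar_subst_lexord_iff:
  assumes "alphabet_order as"
  shows "(ar_subst r u, ar_subst r v) \<in> lexord (letter_less as) \<longleftrightarrow> (u, v) \<in> lexord (letter_less as)"
proof
  note mono = ar_subst_lexord_mono[OF letter_less_linear(1)[OF assms]]
  assume less: "(ar_subst r u, ar_subst r v) \<in> lexord (letter_less as)"
  then have "(v, u) \<notin> lexord (letter_less as)" using mono lexord_letter_less(2)[OF assms] by blast
  moreover have "u \<noteq> v" using less lexord_letter_less(1)[OF assms] by blast
  ultimately show "(u, v) \<in> lexord (letter_less as)"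
    using lexord_letter_less(3)[OF assms] by blast
qed (rule ar_subst_lexord_mono[OF letter_less_linear(1)[OF assms]])

lemma lexord_snoc_same:
  assumes "length u = length v" "(u, v) \<in> lexord R"
  shows "(u @ s, v @ t) \<in> lexord R"
proof -
  consider a t where "v = u @ a # t"
    | p d d' q q' where "(d, d') \<in> R" "u = p @ d # q" "v = p @ d' # q'"
    using assms(2) unfolding lexord_def by blast
  then show ?thesis
  proof cases
    case 2
    then have "((d # q) @ s, (d' # q') @ t) \<in> lexord R" by simp
    then show ?thesis using 2 by (simp add: lexord_append_leftI)
  qed (use assms(1) in simp)
qed

text \<open>A rotation that begins inside a block $lr$ or with the block $r$ begins with $r$; moving this
  leading $r$ to the right-hand side by appending $r$ makes it $r$ followed by a full image of a
  rotation. The remaining rotations begin with a block $lr$ where $l \neq r$, and are themselves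
  images.\<close>

lemma rotate_ar_subst:
  assumes "v \<noteq> []"
  shows "(\<exists>m. rotate i (ar_subst r v) @ [r] = r # ar_subst r (rotate m v)) \<or>
         (\<exists>m. rotate i (ar_subst r v) = ar_subst r (rotate m v) \<and> hd (rotate m v) \<noteq> r)"
    (is "?P (rotate i (ar_subst r v))")
proof -
  have start: "?P (ar_subst r (rotate m v))" for m
  proof (cases "hd (rotate m v) = r")
    case True
    then obtain t where t: "rotate m v = r # t"
      using assms by (metis list.collapse rotate_is_Nil_conv)
    then have "rotate (Suc m) v = t @ [r]" by simp
    then have "ar_subst r (rotate m v) @ [r] = r # ar_subst r (rotate (Suc m) v)" using t by simp
    then show ?thesis by blast
  qed blast
  show ?thesis
  proof (induction i)
    case 0
    show ?case using start[of 0] by simp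
  next
    case (Suc i)
    let ?W = "rotate i (ar_subst r v)"
    from Suc.IH consider m where "?W @ [r] = r # ar_subst r (rotate m v)"
      | m where "?W = ar_subst r (rotate m v)" "hd (rotate m v) \<noteq> r" by blast
    then show ?case
    proof cases
      case 1
      then have "rotate1 ?W = ar_subst r (rotate m v)"
        using assms by (cases ?W) auto
      then show ?thesis using start[of m] by simp
    next
      case 2
      then obtain d t where t: "rotate m v = d # t" "d \<noteq> r"
        using assms by (metis list.collapse rotate_is_Nil_conv)
      then have "rotate (Suc m) v = t @ [d]" by simp
      then have "rotate1 ?W @ [r] = r # ar_subst r (rotate (Suc m) v)" using t 2 by simp
      then show ?thesis by (metis rotate_Suc)
    qed
  qed
qed

text \<open>Hence the rotations beginning with $r$ inherit the last letters of the rotations of $v$.\<close>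

lemma last_before_ar_subst:
  assumes "W @ [r] = r # ar_subst r u" "u \<noteq> []"
  shows "last W = last u"
proof -
  obtain t l where u: "u = t @ [l]" using assms(2) by (cases u rule: rev_cases) auto
  show ?thesis
  proof (cases "l = r")
    case True
    then have "W = r # ar_subst r t" using assms u by simp
    then show ?thesis using True u last_ar_subst[of t r] by simp
  next
    case False
    then have "W @ [r] = (r # ar_subst r t @ [l]) @ [r]" using assms u by simp
    then show ?thesis using u by simp
  qed
qed

text \<open>Two rotations beginning with $r$ compare as the corresponding rotations of $v$, with the same last
  letters. All others end with $r$, so only the comparison of the two kinds is left: there the first
  letters are $r$ and some $d \neq r$, the last letters $e$ and $r$, and the required inequality
  fails only if $r$ lies strictly between $d$ and $e$.\<close>

lemma reverses_last_letters_subst: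
  assumes as: "alphabet_order as" and v: "v \<noteq> []" and rev: "reverses_last_letters as v"
    and extreme: "\<And>s t. s \<in> set v \<Longrightarrow> t \<in> set v \<Longrightarrow> (s, r) \<in> letter_less as \<Longrightarrow>
        (r, t) \<notin> letter_less as"
  shows "reverses_last_letters as (ar_subst r v)"
  unfolding reverses_last_letters_def
proof (intro allI impI)
  fix i j
  let ?U = "rotate i (ar_subst r v)" and ?V = "rotate j (ar_subst r v)"
  assume less: "(?U, ?V) \<in> lexord (letter_less as)"
  have other: "hd W \<in> set v \<and> hd W \<noteq> r \<and> last W = r"
    if "W = ar_subst r (rotate m v)" "hd (rotate m v) \<noteq> r" for W m
  proof -
    have ne: "rotate m v \<noteq> []" using v by simp
    then have "hd W = hd (rotate m v)" using that by (cases "rotate m v") auto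
    moreover have "hd (rotate m v) \<in> set v" using hd_in_set[OF ne] by simp
    ultimately show ?thesis using that last_ar_subst[OF ne] by simp
  qed
  have same: "hd W = r \<and> last W = last (rotate m v) \<and> last W \<in> set v"
    if "W @ [r] = r # ar_subst r (rotate m v)" for W m
  proof -
    have ne: "rotate m v \<noteq> []" using v by simp
    have "hd W = r" using that v by (cases W) (auto dest: sym)
    moreover have "last (rotate m v) \<in> set v" using last_in_set[OF ne] by simp
    ultimately show ?thesis using last_before_ar_subst[OF that ne] by simp
  qed
  have ne: "?U \<noteq> []" "?V \<noteq> []" using v by auto
  have hd: "(hd ?U, hd ?V) \<in> letter_less as" if "hd ?U \<noteq> hd ?V"
    using less that ne by (cases ?U; cases ?V) auto
  have total: "s = t \<or> (s, t) \<in> letter_less as \<or> (t, s) \<in> letter_less as" for s t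
    using letter_less_linear(3)[OF as] by (auto simp: total_on_def)
  consider m n where "?U @ [r] = r # ar_subst r (rotate m v)" "?V @ [r] = r # ar_subst r (rotate n v)"
    | m n where "?U @ [r] = r # ar_subst r (rotate m v)"
        "?V = ar_subst r (rotate n v)" "hd (rotate n v) \<noteq> r"
    | m n where "?U = ar_subst r (rotate m v)" "hd (rotate m v) \<noteq> r"
        "?V @ [r] = r # ar_subst r (rotate n v)"
    | m n where "?U = ar_subst r (rotate m v)" "hd (rotate m v) \<noteq> r"
        "?V = ar_subst r (rotate n v)" "hd (rotate n v) \<noteq> r"
    using rotate_ar_subst[OF v, of i r] rotate_ar_subst[OF v, of j r] by blast
  then show "last ?U = last ?V \<or> (last ?V, last ?U) \<in> letter_less as"
  proof cases
    case 1
    have "(?U @ [r], ?V @ [r]) \<in> lexord (letter_less as)"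
      by (rule lexord_snoc_same[OF _ less]) simp
    then have "(ar_subst r (rotate m v), ar_subst r (rotate n v)) \<in> lexord (letter_less as)"
      using 1 letter_less_linear(1)[OF as] by (simp add: irrefl_def)
    then have "(rotate m v, rotate n v) \<in> lexord (letter_less as)"
      using ar_subst_lexord_iff[OF as] by blast
    then show ?thesis
      using rev same[OF 1(1)] same[OF 1(2)] by (simp add: reverses_last_letters_def)
  next
    case 2
    have U: "hd ?U = r" "last ?U \<in> set v" and V: "hd ?V \<in> set v" "hd ?V \<noteq> r" "last ?V = r"
      using same[OF 2(1)] other[OF 2(2,3)] by auto
    have "(r, hd ?V) \<in> letter_less as" using hd U V by metis
    then have "(last ?U, r) \<notin> letter_less as" using extreme[OF U(2) V(1)] by blast
    then show ?thesis using total[of "last ?U" r] V(3) by auto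
  next
    case 3
    have U: "hd ?U \<in> set v" "hd ?U \<noteq> r" "last ?U = r" and V: "hd ?V = r" "last ?V \<in> set v"
      using other[OF 3(1,2)] same[OF 3(3)] by auto
    have "(hd ?U, r) \<in> letter_less as" using hd U V by metis
    then have "(r, last ?V) \<notin> letter_less as" using extreme[OF U(1) V(2)] by blast
    then show ?thesis using total[of "last ?V" r] U(3) by auto
  next
    case 4
    then show ?thesis using other[OF 4(1,2)] other[OF 4(3,4)] by simp
  qed
qed

section \<open>Clustering\<close>

lemma mset_rotate: "mset (rotate m w) = mset w"
proof (induction m)
  case (Suc m)
  have "mset (rotate1 u) = mset u" for u :: "'a list" by (cases u) auto
  then show ?case using Suc by simp
qed simp

text \<open>The Burrows-Wheeler transform is therefore a rearrangement of the word.\<close>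

lemma map_last_conjugates: "map last (conjugates w) = rotate (length w - 1) w"
proof (rule nth_equalityI)
  fix i assume "i < length (map last (conjugates w))"
  then have i: "i < length w" by (simp add: conjugates_def)
  then have "last (rotate i w) = rotate i w ! (length w - 1)"
    by (subst last_conv_nth) auto
  then show "map last (conjugates w) ! i = rotate (length w - 1) w ! i"
    using i by (simp add: conjugates_def nth_rotate add.commute)
qed (simp add: conjugates_def)

lemma sorted_wrt_concat_replicate:
  assumes "sorted_wrt R bs"
  shows "sorted_wrt (\<lambda>s t. s = t \<or> R s t) (concat (map (\<lambda>b. replicate (f b) b) bs))"
proof -
  have "sorted_wrt (\<lambda>s t. s = t \<or> R s t) (replicate n b)" for n b
    by (induction n) auto
  then show ?thesis
    using assms by (induction bs) (auto simp: sorted_wrt_append)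
qed

lemma mset_concat_replicate_count:
  assumes "distinct bs" "set bs = UNIV"
  shows "mset (concat (map (\<lambda>b. replicate (count_list w b) b) bs)) = mset w"
proof (rule multiset_eqI)
  fix t
  have "count (mset (concat (map (\<lambda>b. replicate (count_list w b) b) bs))) t
      = (if t \<in> set bs then count_list w t else 0)"
    using assms(1) by (induction bs) auto
  then show "count (mset (concat (map (\<lambda>b. replicate (count_list w b) b) bs))) t = count (mset w) t"
    using assms(2) by (simp add: count_mset)
qed

text \<open>Both the transform and the required word are nonincreasing rearrangements of $w$, and such a
  rearrangement is unique.\<close>

lemma clusters_if_reverses_last_letters:
  assumes as: "alphabet_order as" and \<pi>: "symmetric_perm as \<pi>" "bij \<pi>" "\<pi> \<noteq> id"
    and rev: "reverses_last_letters as w"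
  shows "clusters as \<pi> w"
proof -
  note ll = letter_less_linear[OF as]
  define ge where "ge s t \<longleftrightarrow> s = t \<or> (t, s) \<in> letter_less as" for s t
  interpret linorder ge "\<lambda>s t. (t, s) \<in> letter_less as"
    using ll by unfold_locales (auto simp: ge_def irrefl_def total_on_def dest: transD)
  define cs where "cs = (THE cs. lex_listing as w cs)"
  have cs: "lex_listing as w cs"
    unfolding cs_def by (rule theI'[OF lex_listing_ex1[OF as]])
  let ?rhs = "concat (map (\<lambda>a. replicate (count_list w (\<pi> a)) (\<pi> a)) as)"
  have "sorted_wrt (\<lambda>u v. ge (last u) (last v)) cs"
  proof (rule sorted_wrt_mono_rel[rotated])
    show "sorted_wrt (\<lambda>u v. u = v \<or> (u, v) \<in> lexord (letter_less as)) cs"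
      using cs by (simp add: lex_listing_def)
    fix u v assume "u \<in> set cs" "v \<in> set cs" and uv: "u = v \<or> (u, v) \<in> lexord (letter_less as)"
    moreover have "set cs = set (conjugates w)"
      using cs by (metis lex_listing_def set_mset_mset)
    ultimately obtain i j where "u = rotate i w" "v = rotate j w"
      by (auto simp: conjugates_def)
    then show "ge (last u) (last v)"
      using uv rev by (auto simp: reverses_last_letters_def ge_def)
  qed
  then have sorted: "sorted_wrt ge (map last cs)" by (simp add: sorted_wrt_map)
  have mset: "mset (map last cs) = mset w"
  proof -
    have "mset (map last cs) = mset (map last (conjugates w))"
      using cs by (simp add: lex_listing_def)
    then show ?thesis by (simp add: map_last_conjugates mset_rotate)
  qed
  have rev_as: "map \<pi> as = rev as"
    using \<pi>(1) by (intro nth_equalityI) (auto simp: symmetric_perm_def rev_nth)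
  have rhs: "?rhs = concat (map (\<lambda>b. replicate (count_list w b) b) (rev as))"
    by (simp flip: rev_as add: o_def)
  have "sorted_wrt (\<lambda>s t. (t, s) \<in> letter_less as) (rev as)"
    unfolding sorted_wrt_rev by (auto simp: sorted_wrt_iff_nth_less letter_less_def)
  then have "sorted_wrt ge ?rhs"
    unfolding rhs ge_def by (rule sorted_wrt_concat_replicate)
  moreover have "mset ?rhs = mset w"
    unfolding rhs using as by (intro mset_concat_replicate_count) (auto simp: alphabet_order_def)
  ultimately have "map last cs = ?rhs"
    using sorted mset properties_for_sort by metis
  then show ?thesis
    using \<pi> by (simp add: clusters_def bw_transform_def cs_def)
qed

section \<open>Primitivity\<close>

text \<open>Stronger than primitivity, but stable under substitution by a linear computation.\<close>

definition coprime_counts :: "'a list \<Rightarrow> bool" where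
  "coprime_counts w \<longleftrightarrow> (\<forall>m. (\<forall>l. m dvd count_list w l) \<longrightarrow> m = 1)"

lemma coprime_counts_neq_Nil: "coprime_counts w \<Longrightarrow> w \<noteq> []"
  by (auto simp: coprime_counts_def intro!: exI[of _ 2])

lemma count_list_concat_replicate: "count_list (concat (replicate m u)) l = m * count_list u l"
  by (induction m) auto

lemma primitive_if_coprime_counts:
  assumes "coprime_counts w"
  shows "primitive w"
  unfolding primitive_def
proof (intro conjI allI impI)
  show "w \<noteq> []" using assms by (rule coprime_counts_neq_Nil)
  fix u m assume w: "w = concat (replicate m u)"
  then have "m dvd count_list w l" for l by (simp add: count_list_concat_replicate)
  then have "m = 1" using assms by (auto simp: coprime_counts_def)
  then show "u = w" using w by simp
qed

text \<open>Substitution replaces the count of $r$ by the length and keeps the other counts, so common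
  divisors are the same before and after.\<close>

lemma coprime_counts_subst:
  assumes "coprime_counts v"
  shows "coprime_counts (ar_subst r v)"
  unfolding coprime_counts_def
proof (intro allI impI)
  fix m assume dvd: "\<forall>l. m dvd count_list (ar_subst r v) l"
  have "count_list (ar_subst r v) l = (if l = r then length v else count_list v l)" for l
    by (induction v) auto
  then have length: "m dvd length v" and others: "l \<noteq> r \<Longrightarrow> m dvd count_list v l" for l
    using dvd by metis+
  have "length v = (\<Sum>l\<in>insert r (set v). count_list v l)"
    by (rule sum_count_set[symmetric]) auto
  also have "\<dots> = count_list v r + (\<Sum>l\<in>set v - {r}. count_list v l)"
    by (simp add: sum.insert_remove)
  finally have "length v = count_list v r + (\<Sum>l\<in>set v - {r}. count_list v l)" .
  moreover have "m dvd (\<Sum>l\<in>set v - {r}. count_list v l)" using others by (intro dvd_sum) auto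
  ultimately have "m dvd count_list v r" using length by (simp add: dvd_add_left_iff)
  then have "m dvd count_list v l" for l using others by (cases "l = r") auto
  then show "m = 1" using assms by (auto simp: coprime_counts_def)
qed

lemma coprime_counts_rotate: "coprime_counts (rotate m w) \<longleftrightarrow> coprime_counts w"
proof -
  have "count_list (rotate m w) l = count_list w l" for l
    by (metis count_mset mset_rotate)
  then show ?thesis by (simp add: coprime_counts_def)
qed

section \<open>Images of clustering words\<close>

lemma reverses_last_letters_rotate:
  "reverses_last_letters as w \<Longrightarrow> reverses_last_letters as (rotate m w)"
  by (simp add: reverses_last_letters_def rotate_rotate)

definition clustering_core :: "'a list \<Rightarrow> 'a list \<Rightarrow> bool" where
  "clustering_core as w \<longleftrightarrow> coprime_counts w \<and> reverses_last_letters as w"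

lemma clustering_core_single: "clustering_core as [l]"
proof -
  have "rotate i [l] = [l]" for i by (induction i) auto
  then have "reverses_last_letters as [l]" by (simp add: reverses_last_letters_def)
  moreover have "coprime_counts [l]"
    unfolding coprime_counts_def
  proof (intro allI impI)
    show "m = 1" if "\<forall>t. m dvd count_list [l] t" for m
      using spec[OF that, of l] by simp
  qed
  ultimately show ?thesis by (simp add: clustering_core_def)
qed

lemma clustering_core_subst:
  assumes "alphabet_order as" "clustering_core as v"
    and "\<And>s t. s \<in> set v \<Longrightarrow> t \<in> set v \<Longrightarrow> (s, r) \<in> letter_less as \<Longrightarrow>
        (r, t) \<notin> letter_less as"
  shows "clustering_core as (ar_subst r v)"
  unfolding clustering_core_def
proof (intro conjI)
  have v: "coprime_counts v" "reverses_last_letters as v"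
    using assms(2) by (auto simp: clustering_core_def)
  show "coprime_counts (ar_subst r v)" by (rule coprime_counts_subst[OF v(1)])
  show "reverses_last_letters as (ar_subst r v)"
    by (rule reverses_last_letters_subst[OF assms(1) coprime_counts_neq_Nil[OF v(1)] v(2) assms(3)])
qed

lemma clustering_core_image:
  assumes as: "alphabet_order as" and v: "clustering_core as v" "set v \<subseteq> S"
    and extreme: "\<And>i s t. i < k \<Longrightarrow> s \<in> S \<Longrightarrow> t \<in> S \<Longrightarrow> (s, x i) \<in> letter_less as \<Longrightarrow>
        (x i, t) \<notin> letter_less as"
    and S: "\<And>i. i < k \<Longrightarrow> x i \<in> S"
  shows "clustering_core as (ar_image x k v)"
  using v extreme S
proof (induction k arbitrary: v)
  case (Suc k)
  have "clustering_core as (ar_subst (x k) v)"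
    using Suc.prems by (intro clustering_core_subst[OF as]) blast+
  moreover have "set (ar_subst (x k) v) \<subseteq> S"
    using set_ar_subst[of "x k" v] Suc.prems by blast
  ultimately show ?case
    unfolding ar_image_Suc using Suc.prems by (intro Suc.IH) auto
qed simp

lemma clustering_core_rotate: "clustering_core as w \<Longrightarrow> clustering_core as (rotate m w)"
  by (simp add: clustering_core_def coprime_counts_rotate reverses_last_letters_rotate)

lemma two_letters_extreme:
  assumes "alphabet_order as" "r \<in> {l, c}" "s \<in> {l, c}" "t \<in> {l, c}" "(s, r) \<in> letter_less as"
  shows "(r, t) \<notin> letter_less as"
  using assms letter_less_linear(1,2)[OF assms(1)] unfolding irrefl_def trans_def by blast

text \<open>The rotations of $c\,l^n$ supply all the starting words: $lcl$ and $llcl$ are obtained from $n = 2$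
  and $n = 3$. Here $c\,l^n$ is $\sigma_l^n(c)$, and in a two-letter alphabet no letter is in the
  middle.\<close>

lemma clustering_core_one_occurrence:
  assumes "alphabet_order as" "c \<noteq> l"
  shows "clustering_core as (c # replicate n l)"
proof (induction n)
  case 0
  show ?case by (simp add: clustering_core_single)
next
  case (Suc n)
  have "ar_subst l (replicate n l) = replicate n l" by (induction n) auto
  then have "c # replicate (Suc n) l = ar_subst l (c # replicate n l)"
    using assms(2) by simp
  moreover have "clustering_core as (ar_subst l (c # replicate n l))"
  proof (rule clustering_core_subst[OF assms(1) Suc.IH])
    fix s t
    assume "s \<in> set (c # replicate n l)" "t \<in> set (c # replicate n l)" "(s, l) \<in> letter_less as"
    then show "(l, t) \<notin> letter_less as"
      using two_letters_extreme[OF assms(1), of l l c s t] by auto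
  qed
  ultimately show ?case by simp
qed

text \<open>The letter $c$ is placed in the middle of the order, $a < c < b$, because it will be
  the last letter to occur as a rule.\<close>

locale three_letters =
  fixes a b c :: letter
  assumes distinct_letters: "a \<noteq> b" "a \<noteq> c" "b \<noteq> c"
begin

lemma all_letters: "l = a \<or> l = b \<or> l = c"
  using distinct_letters by (cases a; cases b; cases c; cases l) auto

lemma order: "alphabet_order [a, c, b]"
  using distinct_letters all_letters by (auto simp: alphabet_order_def)

lemma letter_less_order: "letter_less [a, c, b] = {(a, c), (a, b), (c, b)}"
  by (auto simp: letter_less_def less_Suc_eq nth_Cons')

lemma not_middle:
  assumes "r \<noteq> c" "(s, r) \<in> letter_less [a, c, b]"
  shows "(r, t) \<notin> letter_less [a, c, b]"
  using assms distinct_letters unfolding letter_less_order by blast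

lemma clustering_core_order:
  assumes "clustering_core [a, c, b] w"
  shows "primitive w" "perfectly_clustering w"
proof -
  show "primitive w"
    using assms by (simp add: clustering_core_def primitive_if_coprime_counts)
  define \<pi> where "\<pi> t = (if t = a then b else if t = b then a else t)" for t
  have "\<pi> \<circ> \<pi> = id" by (auto simp: \<pi>_def)
  then have "bij \<pi>" by (metis o_bij)
  moreover have "\<pi> \<noteq> id" using distinct_letters by (metis \<pi>_def id_apply)
  moreover have "symmetric_perm [a, c, b] \<pi>"
    using distinct_letters by (auto simp: symmetric_perm_def \<pi>_def less_Suc_eq)
  ultimately show "perfectly_clustering w"
    using assms order clusters_if_reverses_last_letters
    unfolding perfectly_clustering_def clustering_core_def by blast
qed

text \<open>The rules before stage $k$ are extreme in the order, and the middle letter $c$ is used only on words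
  over two letters.\<close>

lemma clustering_core_late_image:
  assumes early: "\<And>i. i < k \<Longrightarrow> x i \<noteq> c" and run: "\<And>i. k \<le> i \<Longrightarrow> i < K \<Longrightarrow> x i = c"
    and "k \<le> K" and v: "clustering_core [a, c, b] v" "set v \<subseteq> {l, c}"
  shows "clustering_core [a, c, b] (ar_image x K v)"
proof -
  have K: "k + (K - k) = K" using \<open>k \<le> K\<close> by simp
  have "clustering_core [a, c, b] (ar_image (\<lambda>i. x (k + i)) (K - k) v)"
  proof (rule clustering_core_image[OF order v])
    fix i s t assume "i < K - k" "s \<in> {l, c}" "t \<in> {l, c}" "(s, x (k + i)) \<in> letter_less [a, c, b]"
    then show "(x (k + i), t) \<notin> letter_less [a, c, b]"
      using two_letters_extreme[OF order, of "x (k + i)" l c s t] run[of "k + i"]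
      by (metis insertI1 insertI2 less_diff_conv2 add.commute le_add1 less_diff_conv)
  qed (use run in simp)
  then have "clustering_core [a, c, b] (ar_image x k (ar_image (\<lambda>i. x (k + i)) (K - k) v))"
  proof (rule clustering_core_image[OF order _ subset_UNIV])
    fix i s t assume "i < k" "(s, x i) \<in> letter_less [a, c, b]"
    then show "(x i, t) \<notin> letter_less [a, c, b]"
      using early[of i] not_middle by blast
  qed simp
  then show ?thesis by (simp add: K flip: ar_image_add)
qed

end

section \<open>Long clustering words with many occurrences of each letter\<close>

lemma AR_rules_with_prefix: "\<exists>x. AR_rules x \<and> (\<forall>i<length p. x i = p ! i)"
proof -
  define x where "x i = (if i < length p then p ! i else [LA, LB, LC] ! (i mod 3))" for i
  have "infinite {i. x i = l}" for l
  proof -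
    obtain j where j: "j < 3" "[LA, LB, LC] ! j = l"
    proof (cases l)
      case LA then show ?thesis using that[of 0] by simp
    next
      case LB then show ?thesis using that[of 1] by simp
    next
      case LC then show ?thesis using that[of 2] by simp
    qed
    have "x (3 * (m + length p) + j) = l" for m
    proof -
      have "(3 * (m + length p) + j) mod 3 = j"
        using j(1) by (simp only: mod_mult_self4 mod_less)
      then show ?thesis using j(2) by (simp only: x_def) simp
    qed
    moreover have "m \<le> 3 * (m + length p) + j" for m by simp
    ultimately show ?thesis unfolding infinite_nat_iff_unbounded_le by blast
  qed
  then have "AR_rules x" by (simp add: AR_rules_def)
  then show ?thesis by (intro exI[of _ x]) (simp add: x_def)
qed

text \<open>After the rules $a, b$ the third word is $caba$, and each rule $c$ appends it to the first, which
  ends up as $aba(caba)^n$.\<close>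

lemma clustering_word_with_many_letters:
  "\<exists>w. AR_word w \<and> primitive w \<and> perfectly_clustering w \<and> (\<forall>l. count_list w l \<ge> n)"
proof -
  interpret three_letters LA LB LC by standard auto
  let ?p = "LA # LB # replicate n LC"
  obtain x where x: "AR_rules x" and p: "\<forall>i<length ?p. x i = ?p ! i"
    using AR_rules_with_prefix by blast
  have x01: "x 0 = LA" "x (Suc 0) = LB" using p by auto
  have run: "x i = LC" if "2 \<le> i" "i < 2 + n" for i
    using that p by (simp add: nth_Cons' numeral_2_eq_2)
  define w where "w = AR_stage x (2 + n) LA"
  have C: "AR_stage x (2 + i) LC = [LC, LA, LB, LA]" if "i \<le> n" for i
    using that by (induction i) (auto simp: x01 run numeral_2_eq_2)
  have "count_list (AR_stage x (2 + i) LA) l \<ge> i" if "i \<le> n" for i l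
    using that
  proof (induction i)
    case (Suc i)
    have "AR_stage x (2 + Suc i) LA = AR_stage x (2 + i) LA @ [LC, LA, LB, LA]"
      using Suc.prems run[of "2 + i"] C[of i] by simp
    moreover have "count_list [LC, LA, LB, LA] l \<ge> 1" by (cases l) auto
    ultimately show ?case using Suc by (simp del: count_list.simps)
  qed simp
  then have "\<forall>l. count_list w l \<ge> n" by (simp add: w_def)
  moreover have "clustering_core [LA, LC, LB] (ar_image x (2 + n) [LA])"
  proof (rule clustering_core_late_image)
    show "x i \<noteq> LC" if "i < 2" for i
      using that x01 by (auto simp: less_Suc_eq numeral_2_eq_2)
  qed (use run clustering_core_single in auto)
  then have "primitive w" "perfectly_clustering w"
    using clustering_core_order by (simp_all add: w_def)
  moreover have "AR_word w"
    using x AR_language_ofI[of w x] unfolding AR_word_def AR_language_def w_def by blast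
  ultimately show ?thesis by blast
qed

section \<open>A clustering word of length at least 22 in every language\<close>

lemma length_AR_stage_constant_rule:
  assumes "\<And>i. i < q \<Longrightarrow> x i = a"
  shows "length (AR_stage x q l) = (if l = a then 1 else Suc q)"
  using assms by (induction q arbitrary: l) auto

lemma AR_rules_first_letters:
  assumes "AR_rules x"
  obtains a b c q k where "three_letters a b c" "0 < q" "q < k"
    "\<And>i. i < q \<Longrightarrow> x i = a" "x q = b" "\<And>i. i < k \<Longrightarrow> x i \<noteq> c" "x k = c"
proof -
  obtain l0 where "l0 \<noteq> x 0" by (metis letter.distinct(1))
  then have ex: "\<exists>i. x i \<noteq> x 0" using AR_rules_later[OF assms, of 0] by metis
  define q where "q = (LEAST i. x i \<noteq> x 0)"
  have q: "x q \<noteq> x 0" unfolding q_def by (rule LeastI_ex[OF ex])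
  have before_q: "x i = x 0" if "i < q" for i
    using not_less_Least[of i "\<lambda>i. x i \<noteq> x 0"] that unfolding q_def by blast
  obtain c where c: "c \<noteq> x 0" "c \<noteq> x q"
    using q by (metis letter.distinct letter.exhaust)
  have ex: "\<exists>i. x i = c" using AR_rules_later[OF assms, of 0] by metis
  define k where "k = (LEAST i. x i = c)"
  have k: "x k = c" unfolding k_def by (rule LeastI_ex[OF ex])
  have before_k: "x i \<noteq> c" if "i < k" for i
    using not_less_Least[of i "\<lambda>i. x i = c"] that unfolding k_def by blast
  have "q < k" using k c before_q by (metis linorder_neqE_nat)
  moreover have "0 < q" using q by (metis gr0I)
  moreover have "three_letters (x 0) (x q) c" using q c by unfold_locales auto
  ultimately show ?thesis using that[of "x 0" "x q" c q k] before_q before_k k by blast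
qed

text \<open>After the first two rules the words of stage 2 are $aba$, $ba$, $caba$. What is a factor at stage 2
  is $c\,\sigma_c(lcl)$, preceded by two unknown letters; whatever they are, their images end with
  the image of $l$, and $l c\,\sigma_c(lcl) = \sigma_c(llcl)$.\<close>

lemma (in three_letters) image_in_AR_language:
  assumes x: "AR_rules x" and rules: "x 0 = a" "x 1 = b" "x 2 = c" "x 3 = l" "l \<noteq> c"
  shows "ar_image x 3 [l, l, c, l] \<in> AR_language_of x"
proof -
  define y where "y = (\<lambda>i. x (2 + i))"
  define z where "z = (\<lambda>i. y (1 + i))"
  have y: "AR_rules y" and z: "AR_rules z"
    unfolding y_def z_def using x by (intro AR_rules_shift; simp)+
  have "[l, c, l] \<in> AR_language_of z"
    using return_factor_in_AR_language[OF z, of c] rules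
    by (simp add: y_def z_def numeral_2_eq_2 numeral_3_eq_3)
  then obtain s where "[s, l, c, l] \<in> AR_language_of z"
    using AR_language_left_extension[OF z] by blast
  then have "ar_image y 1 [s, l, c, l] \<in> AR_language_of y"
    using ar_image_in_language[of _ y 1] by (simp add: z_def)
  moreover have "ar_image y 1 [s, l, c, l] = (if s = c then [] else [s]) @ c # ar_subst c [l, c, l]"
    using rules by (simp add: ar_image_Suc y_def numeral_2_eq_2)
  ultimately have "c # ar_subst c [l, c, l] \<in> AR_language_of y"
    by (metis AR_language_of_sublist suffix_imp_sublist suffixI)
  then obtain t t' where "t' # t # c # ar_subst c [l, c, l] \<in> AR_language_of y"
    using AR_language_left_extension[OF y] by blast
  then have "ar_image x 2 (t' # t # c # ar_subst c [l, c, l]) \<in> AR_language_of x"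
    using ar_image_in_language[of _ x 2] by (simp add: y_def)
  moreover have "suffix (AR_stage x 2 l) (AR_stage x 2 t' @ AR_stage x 2 t)"
    using all_letters[of l] all_letters[of t] all_letters[of t'] rules distinct_letters
    by (auto simp: numeral_2_eq_2 suffix_to_prefix)
  then obtain p where "AR_stage x 2 t' @ AR_stage x 2 t = p @ AR_stage x 2 l"
    by (auto simp: suffix_def)
  then have "ar_image x 2 (t' # t # c # ar_subst c [l, c, l])
      = p @ ar_image x 2 (l # c # ar_subst c [l, c, l])"
    by (simp add: ar_image_def)
  moreover have "ar_image x 3 [l, l, c, l] = ar_image x 2 (l # c # ar_subst c [l, c, l])"
    using rules ar_image_Suc[of x 2] by (simp add: numeral_3_eq_3 numeral_2_eq_2)
  ultimately show ?thesis
    by (metis AR_language_of_sublist suffix_imp_sublist suffixI)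
qed

text \<open>In terms of lengths at stage $k$, with $l$ and $c$ standing for their words, the image of $lcl$ has
  length at least $2(l + c) + c$. For $k \geq 3$ this suffices, since then $l \geq 2$ and
  $c \geq 6$. For $k = 2$ only $c = 4$ is available; two consecutive rules $c$ give
  $2(2 + 8) + 4 = 24$, and with a single one the image of $llcl$ replaces that of $lcl$.\<close>

lemma clustering_word_of_length_22:
  assumes x: "AR_rules x"
  shows "\<exists>w\<in>AR_language_of x. primitive w \<and> perfectly_clustering w \<and> length w \<ge> 22"
proof -
  obtain a b c q k where abc: "three_letters a b c" and q: "0 < q" "q < k"
      and before_q: "\<And>i. i < q \<Longrightarrow> x i = a" and xq: "x q = b"
      and before_k: "\<And>i. i < k \<Longrightarrow> x i \<noteq> c" and xk: "x k = c"
    using AR_rules_first_letters[OF x] by metis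
  interpret three_letters a b c by (fact abc)
  have ex: "\<exists>i. k \<le> i \<and> x i \<noteq> c" using AR_rules_later[OF x, of k a] distinct_letters by auto
  define K where "K = (LEAST i. k \<le> i \<and> x i \<noteq> c)"
  define l where "l = x K"
  have K: "k \<le> K" "l \<noteq> c" using LeastI_ex[OF ex] by (auto simp: K_def l_def)
  have run: "x i = c" if "k \<le> i" "i < K" for i
    using not_less_Least[of i "\<lambda>i. k \<le> i \<and> x i \<noteq> c"] that by (auto simp: K_def)
  have "k < K" using K xk by (metis l_def le_neq_implies_less)
  let ?len = "\<lambda>i t. length (AR_stage x i t)"
  have len_q: "?len q t = (if t = a then 1 else Suc q)" for t
    by (rule length_AR_stage_constant_rule) (rule before_q)
  have len_Suc_q: "?len (Suc q) c = 2 * Suc q" "?len (Suc q) t \<ge> 2" for t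
    using len_q q distinct_letters by (auto simp: xq)
  have len_k: "?len k l \<ge> 2" "?len k c \<ge> 2 * Suc q"
    using length_AR_stage_mono[of "Suc q" k x] len_Suc_q q by (metis Suc_leI le_trans)+
  have "?len (Suc k) l = ?len k l + ?len k c" using K xk by simp
  moreover have "?len (Suc k) l \<le> ?len K l"
    by (rule length_AR_stage_mono) (use \<open>k < K\<close> in simp)
  moreover have "?len k c \<le> ?len K c" by (rule length_AR_stage_mono[OF K(1)])
  ultimately have len_K: "?len K l \<ge> ?len k l + ?len k c" "?len K c \<ge> ?len k c" by simp_all
  have core: "clustering_core [a, c, b] (ar_image x K v)"
    if "clustering_core [a, c, b] v" "set v \<subseteq> {l, c}" for v
    using clustering_core_late_image[OF before_k run K(1) that] .
  have word: "primitive (ar_image x K v)" "perfectly_clustering (ar_image x K v)"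
    if "v = rotate 2 (c # replicate n l)" for v n
  proof -
    have "clustering_core [a, c, b] v"
      using that clustering_core_rotate[OF clustering_core_one_occurrence[OF order]] K(2) by metis
    moreover have "set v \<subseteq> {l, c}" using that by auto
    ultimately show "primitive (ar_image x K v)" "perfectly_clustering (ar_image x K v)"
      using clustering_core_order[OF core] by auto
  qed
  show ?thesis
  proof (cases "k = 2 \<and> K = 3")
    case True
    then have "q = 1" using q by simp
    then have "x 0 = a" "x 1 = b" "x 2 = c" "x 3 = l"
      using before_q[of 0] xq xk True by (auto simp: l_def)
    then have "ar_image x K [l, l, c, l] \<in> AR_language_of x"
      using image_in_AR_language[OF x] K(2) True by simp
    moreover have "length (ar_image x K [l, l, c, l]) = 3 * ?len K l + ?len K c"
      by (simp add: length_ar_image)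
    then have "length (ar_image x K [l, l, c, l]) \<ge> 22"
      using len_K len_k \<open>q = 1\<close> by simp
    moreover have "[l, l, c, l] = rotate 2 (c # replicate 3 l)"
      by (simp add: numeral_2_eq_2 numeral_3_eq_3)
    ultimately show ?thesis using word by blast
  next
    case False
    have "[l, c, l] \<in> AR_language_of (\<lambda>i. x (K + i))"
      using return_factor_in_AR_language[OF AR_rules_shift[OF x, of K], of c] K(2)
      by (simp add: l_def)
    then have "ar_image x K [l, c, l] \<in> AR_language_of x" by (rule ar_image_in_language)
    moreover have "length (ar_image x K [l, c, l]) = 2 * ?len K l + ?len K c"
      by (simp add: length_ar_image)
    then have "length (ar_image x K [l, c, l]) \<ge> 22"
    proof (cases "k \<ge> 3")
      case True
      have "?len k c \<ge> 6"
      proof (cases "q = 1")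
        \<comment> \<open>At stage 2 the word of \<open>c\<close> has length 4, and the rule of stage 2, not being \<open>c\<close>,
          appends at least 2 letters; for \<open>q \<ge> 2\<close> its length is at least 6 already at stage \<open>q + 1\<close>.\<close>
        case True
        have "x 2 \<noteq> c" using before_k \<open>k \<ge> 3\<close> by simp
        then have "?len (Suc 2) c = ?len 2 c + ?len 2 (x 2)"
          unfolding AR_stage.simps by simp
        moreover have "?len 2 c = 4" "?len 2 (x 2) \<ge> 2"
          using len_Suc_q(1) len_Suc_q(2)[of "x 2"] True by (simp_all only: Suc_1)
        ultimately have "?len (Suc 2) c \<ge> 6" by linarith
        then show ?thesis using length_AR_stage_mono[of "Suc 2" k x c] True \<open>k \<ge> 3\<close> by simp
      qed (use len_k q in simp)
      then show ?thesis using len_K len_k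
          \<open>length (ar_image x K [l, c, l]) = 2 * ?len K l + ?len K c\<close> by simp
    next
      case k: False
      then have "k = 2" "q = 1" using q by auto
      then have "Suc (Suc k) \<le> K" using \<open>k < K\<close> False by simp
      then have "?len (Suc (Suc k)) l = ?len k l + ?len k c + ?len k c"
        using run[of "Suc k"] xk K(2) by simp
      moreover have "?len K l \<ge> ?len (Suc (Suc k)) l"
        using \<open>Suc (Suc k) \<le> K\<close> by (rule length_AR_stage_mono)
      ultimately show ?thesis using len_K len_k \<open>q = 1\<close>
          \<open>length (ar_image x K [l, c, l]) = 2 * ?len K l + ?len K c\<close> by simp
    qed
    moreover have "[l, c, l] = rotate 2 (c # replicate 2 l)"
      by (simp add: numeral_2_eq_2)
    ultimately show ?thesis using word by blast
  qed
qed

theorem corollary15: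
  "(\<forall>n N. \<exists>w. AR_word w \<and> primitive w \<and> perfectly_clustering w \<and>
       length w \<ge> N \<and> (\<forall>l. count_list w l \<ge> n)) \<and>
   (\<forall>L. AR_language L \<longrightarrow>
       (\<exists>w\<in>L. primitive w \<and> perfectly_clustering w \<and> length w \<ge> 22))"
proof (intro conjI allI impI)
  fix n N
  obtain w where w: "AR_word w" "primitive w" "perfectly_clustering w"
    "\<forall>l. count_list w l \<ge> max n N"
    using clustering_word_with_many_letters by blast
  moreover have "length w \<ge> N"
    using w(4) count_le_length[of w LA] by (meson le_trans max.boundedE)
  ultimately show "\<exists>w. AR_word w \<and> primitive w \<and> perfectly_clustering w \<and>
       length w \<ge> N \<and> (\<forall>l. count_list w l \<ge> n)"
    by (meson max.boundedE)
next
  fix L assume "AR_language L"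
  then show "\<exists>w\<in>L. primitive w \<and> perfectly_clustering w \<and> length w \<ge> 22"
    using clustering_word_of_length_22 by (auto simp: AR_language_def)
qed

end
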